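(* Let $\phi$ be an analytic selfmap of $\mathbb{U}$ having Denjoy-Wolff point $\omega$ in $\partial\mathbb{U}$. Suppose that $\lambda$ is an eigenvalue of $C_\phi: H^2(\mathbb{U})\to H^2(\mathbb{U})$ having a corresponding eigenvector that is an outer function. Then $C_\phi-\lambda I$ has dense range.
   Context: $\mathbb{U}$ is the open unit disc in $\mathbb{C}$ and $H^2(\mathbb{U})$ is the classical Hardy space of analytic functions on $\mathbb{U}$ with square-summable Maclaurin coefficients. An analytic selfmap of $\mathbb{U}$ is an analytic function $\phi$ on $\mathbb{U}$ with $\phi(\mathbb{U})\subseteq\mathbb{U}$; $C_\phi f=f\circ\phi$ is the composition operator, which is bounded on $H^2(\mathbb{U})$. If $\phi$ is not an elliptic automorphism of $\mathbb{U}$, its Denjoy-Wolff point is the unique $\omega$ in the closed disc with $\phi^{[n]}(z)\to\omega$ for each $z\in\mathbb{U}$, where $\phi^{[n]}$ is the $n$-th iterate of $\phi$. *)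

theory Defs
  imports "HOL-Complex_Analysis.Complex_Analysis"
begin

abbreviation unit_disc :: "complex set" where
  "unit_disc \<equiv> ball 0 1"

definition maclaurin_coeff :: "(complex \<Rightarrow> complex) \<Rightarrow> nat \<Rightarrow> complex" where
  "maclaurin_coeff f n = (deriv ^^ n) f 0 / fact n"

text \<open>A function on the disc is represented by its extension by 0 to the whole plane, so that
  equality of elements of \<open>H\<^sup>2\<close> is equality in HOL and the pointwise linear operations stay
  inside the carrier.\<close>

definition hardy2 :: "(complex \<Rightarrow> complex) set" where
  "hardy2 = {f. f holomorphic_on unit_disc \<and> (\<forall>z. z \<notin> unit_disc \<longrightarrow> f z = 0) \<and>
                summable (\<lambda>n. (cmod (maclaurin_coeff f n))\<^sup>2)}"

definition hardy2_norm :: "(complex \<Rightarrow> complex) \<Rightarrow> real" where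
  "hardy2_norm f = sqrt (\<Sum>n. (cmod (maclaurin_coeff f n))\<^sup>2)"

text \<open>The restriction to \<open>hardy2\<close> in the approximants only keeps \<open>hardy2_norm\<close> away from
  arguments for which its series diverges; it is vacuous for subsets of \<open>hardy2\<close>.\<close>

definition dense_in_hardy2 :: "(complex \<Rightarrow> complex) set \<Rightarrow> bool" where
  "dense_in_hardy2 S \<longleftrightarrow>
     (\<forall>g \<in> hardy2. \<forall>e > 0. \<exists>h \<in> S \<inter> hardy2. hardy2_norm (\<lambda>z. h z - g z) < e)"

definition analytic_selfmap :: "(complex \<Rightarrow> complex) \<Rightarrow> bool" where
  "analytic_selfmap \<phi> \<longleftrightarrow> \<phi> holomorphic_on unit_disc \<and> \<phi> ` unit_disc \<subseteq> unit_disc"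

text \<open>The identity counts as elliptic: it has no Denjoy-Wolff point.\<close>

definition elliptic_automorphism :: "(complex \<Rightarrow> complex) \<Rightarrow> bool" where
  "elliptic_automorphism \<phi> \<longleftrightarrow>
     \<phi> holomorphic_on unit_disc \<and> bij_betw \<phi> unit_disc unit_disc \<and> (\<exists>p \<in> unit_disc. \<phi> p = p)"

definition denjoy_wolff_point :: "(complex \<Rightarrow> complex) \<Rightarrow> complex \<Rightarrow> bool" where
  "denjoy_wolff_point \<phi> \<omega> \<longleftrightarrow>
     analytic_selfmap \<phi> \<and> \<not> elliptic_automorphism \<phi> \<and> \<omega> \<in> cball 0 1 \<and>
     (\<forall>z \<in> unit_disc. (\<lambda>n. (\<phi> ^^ n) z) \<longlonglongrightarrow> \<omega>)"

definition composition_op ::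
    "(complex \<Rightarrow> complex) \<Rightarrow> (complex \<Rightarrow> complex) \<Rightarrow> (complex \<Rightarrow> complex)" where
  "composition_op \<phi> f = (\<lambda>z. if z \<in> unit_disc then f (\<phi> z) else 0)"

definition hardy2_eigenvector ::
    "((complex \<Rightarrow> complex) \<Rightarrow> (complex \<Rightarrow> complex)) \<Rightarrow> complex \<Rightarrow> (complex \<Rightarrow> complex) \<Rightarrow> bool" where
  "hardy2_eigenvector T \<mu> f \<longleftrightarrow> f \<in> hardy2 \<and> f \<noteq> (\<lambda>z. 0) \<and> T f = (\<lambda>z. \<mu> * f z)"

text \<open>The classical definition: \<open>k\<close> is the logarithm \<open>log \<psi>(e\<^sup>i\<^sup>t)\<close> of a positive measurable
  function \<open>\<psi>\<close> on the circle with \<open>log \<psi>\<close> integrable (a posteriori \<open>\<psi>\<close> is a.e. the modulus of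
  the boundary function of \<open>f\<close>).\<close>

definition outer_function :: "(complex \<Rightarrow> complex) \<Rightarrow> bool" where
  "outer_function f \<longleftrightarrow>
     (\<exists>(c :: complex) (k :: real \<Rightarrow> real).
        cmod c = 1 \<and> set_integrable lborel {0..2 * pi} k \<and>
        (\<forall>z \<in> unit_disc.
           f z = c * exp (1 / (2 * of_real pi) *
             (LINT t:{0..2 * pi}|lborel. (cis t + z) / (cis t - z) * of_real (k t)))))"

end

theory Submission
  imports Defs
begin

text \<open>Let \<open>f\<close> be the outer eigenvector. If \<open>h\<close> is bounded and analytic then, by telescoping,
  \<open>f \<cdot> (h - h \<circ> \<phi>\<^sup>n)\<close> lies in the range of \<open>C\<^sub>\<phi> - \<mu>\<close>. For \<open>h z = (z - \<omega>) u z\<close> the functions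
  \<open>f \<cdot> (h \<circ> \<phi>\<^sup>n)\<close> tend to 0 in norm, because analytic functions bounded by 1 whose values at 0 tend
  to a unimodular constant converge, as multipliers of \<open>H\<^sup>2\<close>, strongly to that constant. So
  the closure of the range contains \<open>f \<cdot> (z - \<omega>) \<cdot> u\<close> for all bounded analytic \<open>u\<close>. The same
  convergence principle removes the factor \<open>z - \<omega>\<close>, and then \<open>f\<close>: as \<open>f\<close> is outer, there are
  bounded analytic \<open>u\<^sub>n\<close> with \<open>\<bar>f u\<^sub>n\<bar> \<le> 1\<close> and \<open>f 0 \<cdot> u\<^sub>n 0\<close> tending to a unimodular constant.\<close>

section \<open>Mean squares on circles\<close>

text \<open>The circle is parametrised by angle with total mass 2 pi, so factors 1/(2 pi) stay
  explicit. Restricting the space turns set integrals into plain Bochner integrals over a finite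
  measure.\<close>

abbreviation circle_measure :: "real measure" where
  "circle_measure \<equiv> restrict_space lborel {0..2 * pi}"

lemma finite_measure_circle: "finite_measure circle_measure"
  by (rule finite_measureI) (simp add: emeasure_restrict_space space_restrict_space)

lemma borel_measurable_circle:
  assumes "f \<in> borel_measurable borel"
  shows "f \<in> borel_measurable circle_measure"
  using assms by (simp add: measurable_restrict_space1)

lemma integrable_circle_bounded:
  fixes f :: "real \<Rightarrow> 'a::{banach, second_countable_topology}"
  assumes "f \<in> borel_measurable circle_measure" and "\<And>t. norm (f t) \<le> B"
  shows "integrable circle_measure f"
  using finite_measure.integrable_const_bound[OF finite_measure_circle, of f B] assms by auto

lemma borel_measurable_cis [measurable]: "cis \<in> borel_measurable borel"
  by (intro borel_measurable_continuous_onI continuous_intros)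

lemma integral_circle_const:
  "(LINT t|circle_measure. (c::'a::{banach, second_countable_topology})) = (2 * pi) *\<^sub>R c"
  by (subst integral_restrict_space) (auto simp: measure_def)

text \<open>For \<open>k \<noteq> 0\<close> the antiderivative
  \<open>cis (k * t) / (\<i> * k)\<close> takes equal values at 0 and 2 pi. This is the
  orthogonality relation behind Parseval's identity.\<close>

lemma integral_circle_cis:
  fixes k :: int
  shows "(LINT t|circle_measure. cis (of_int k * t)) = (if k = 0 then of_real (2 * pi) else 0)"
proof (cases "k = 0")
  case True
  then have "(LINT t|circle_measure. cis (of_int k * t)) = (LINT t|circle_measure. (1::complex))"
    by simp
  with True show ?thesis
    unfolding integral_circle_const by (simp add: scaleR_conv_of_real)
next
  case False
  have ii: "\<i> * x * \<i> = - x" for x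
    by (simp add: mult.commute[of \<i> x] mult.assoc)
  have "(LINT t|lborel. indicator {0..2 * pi} t *\<^sub>R cis (of_int k * t)) =
      cis (of_int k * (2 * pi)) / (\<i> * of_int k) - cis (of_int k * 0) / (\<i> * of_int k)"
  proof (rule integral_FTC_Icc)
    fix t :: real
    show "((\<lambda>t. cis (of_int k * t) / (\<i> * of_int k)) has_vector_derivative cis (of_int k * t))
        (at t within {0..2 * pi})"
      unfolding cis_conv_exp using False
      by (auto intro!: derivative_eq_intros has_vector_derivative_real_field simp: scaleR_conv_of_real
            ii simp flip: mult.assoc)
  qed (auto intro!: continuous_intros)
  moreover have "cis (of_int k * (2 * pi)) = 1"
    using cis_multiple_2pi[of "of_int k"] by (simp add: mult.commute)
  ultimately show ?thesis
    using False by (subst integral_restrict_space) auto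
qed

lemma parseval_circle_finite:
  fixes c :: "nat \<Rightarrow> complex"
  shows "(LINT t|circle_measure. (cmod (\<Sum>n<N. c n * cis (of_nat n * t)))\<^sup>2) =
    2 * pi * (\<Sum>n<N. (cmod (c n))\<^sup>2)"
proof -
  have int: "integrable circle_measure (\<lambda>t. a * cis (of_int k * t))" for a k
    by (rule integrable_circle_bounded[where B="cmod a"])
       (auto simp: norm_mult intro!: borel_measurable_circle)
  \<comment> \<open>The squared modulus becomes a double sum over frequencies m - n. These may be
    negative, hence the passage to \<open>int\<close>; integration leaves only the diagonal.\<close>
  have eq: "complex_of_real ((cmod (\<Sum>n<N. c n * cis (of_nat n * t)))\<^sup>2) =
      (\<Sum>m<N. \<Sum>n<N. (c m * cnj (c n)) * cis (of_int (int m - int n) * t))" for t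
  proof -
    have "cis (of_int (int m - int n) * t) = cis (of_nat m * t) * cnj (cis (of_nat n * t))" for m n
      by (simp add: cis_cnj cis_mult algebra_simps)
    then show ?thesis
      unfolding complex_norm_square cnj_sum sum_product
      by (intro sum.cong refl) (simp add: mult_ac)
  qed
  have "complex_of_real (LINT t|circle_measure. (cmod (\<Sum>n<N. c n * cis (of_nat n * t)))\<^sup>2) =
     (LINT t|circle_measure. complex_of_real ((cmod (\<Sum>n<N. c n * cis (of_nat n * t)))\<^sup>2))"
    by (rule integral_complex_of_real[symmetric])
  also have "\<dots> = (\<Sum>m<N. \<Sum>n<N. (c m * cnj (c n)) *
      (LINT t|circle_measure. cis (of_int (int m - int n) * t)))"
    unfolding eq using int by (simp add: integral_sum integrable_sum del: of_int_diff)
  also have "\<dots> = (\<Sum>m<N. (c m * cnj (c m)) * of_real (2 * pi))"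
    unfolding integral_circle_cis by (intro sum.cong refl) (simp add: if_distrib sum.delta cong: if_cong)
  also have "\<dots> = complex_of_real (2 * pi * (\<Sum>n<N. (cmod (c n))\<^sup>2))"
    by (simp add: complex_norm_square sum_distrib_left sum_distrib_right mult_ac flip: of_real_power)
  finally show ?thesis
    using of_real_eq_iff by blast
qed

text \<open>All partial sums are bounded by the sum of the moduli of the coefficients. This constant
  is integrable on the circle, so dominated convergence carries the finite identity to the
  limit.\<close>

lemma parseval_circle:
  fixes c :: "nat \<Rightarrow> complex"
  assumes "summable (\<lambda>n. cmod (c n))"
  shows "(\<lambda>n. (cmod (c n))\<^sup>2) sums
      ((LINT t|circle_measure. (cmod (\<Sum>n. c n * cis (of_nat n * t)))\<^sup>2) / (2 * pi))"
    and "integrable circle_measure (\<lambda>t. (cmod (\<Sum>n. c n * cis (of_nat n * t)))\<^sup>2)"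
proof -
  let ?S = "\<lambda>N t. \<Sum>n<N. c n * cis (of_nat n * t)"
  let ?F = "\<lambda>t. \<Sum>n. c n * cis (of_nat n * t)"
  have conv: "(\<lambda>N. ?S N t) \<longlonglongrightarrow> ?F t" for t
    using assms by (intro summable_LIMSEQ summable_norm_cancel[where f="\<lambda>n. c n * cis (of_nat n * t)"])
       (simp add: norm_mult)
  have meas: "(\<lambda>t. (cmod (?S N t))\<^sup>2) \<in> borel_measurable circle_measure" for N
    by (intro borel_measurable_circle) measurable
  have bound: "(cmod (?S N t))\<^sup>2 \<le> (\<Sum>n. cmod (c n))\<^sup>2" for N t
  proof (intro power_mono norm_ge_zero)
    have "cmod (?S N t) \<le> (\<Sum>n<N. cmod (c n))"
      by (rule order_trans[OF norm_sum]) (simp add: norm_mult)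
    also have "\<dots> \<le> (\<Sum>n. cmod (c n))"
      by (rule sum_le_suminf[OF assms]) auto
    finally show "cmod (?S N t) \<le> (\<Sum>n. cmod (c n))" .
  qed
  have limm: "(\<lambda>t. (cmod (?F t))\<^sup>2) \<in> borel_measurable circle_measure"
    by (rule borel_measurable_LIMSEQ_real[where u="\<lambda>N t. (cmod (?S N t))\<^sup>2", OF _ meas])
       (intro tendsto_intros conv)
  note dom = integral_dominated_convergence[where w="\<lambda>_. (\<Sum>n. cmod (c n))\<^sup>2" and
      s="\<lambda>N t. (cmod (?S N t))\<^sup>2", OF limm meas]
      integrable_dominated_convergence[where w="\<lambda>_. (\<Sum>n. cmod (c n))\<^sup>2" and
      s="\<lambda>N t. (cmod (?S N t))\<^sup>2", OF limm meas]
  have const: "integrable circle_measure (\<lambda>_. (\<Sum>n. cmod (c n))\<^sup>2)"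
    by (rule integrable_circle_bounded[OF _ order_refl]) auto
  have AE1: "AE t in circle_measure. (\<lambda>N. (cmod (?S N t))\<^sup>2) \<longlonglongrightarrow> (cmod (?F t))\<^sup>2"
    by (intro always_eventually allI tendsto_intros conv)
  have AE2: "AE t in circle_measure. norm ((cmod (?S N t))\<^sup>2) \<le> (\<Sum>n. cmod (c n))\<^sup>2" for N
    using bound by (intro always_eventually allI) (auto simp: norm_power)
  show "integrable circle_measure (\<lambda>t. (cmod (?F t))\<^sup>2)"
    by (rule dom(2)[OF const AE1 AE2])
  have "(\<lambda>N. (LINT t|circle_measure. (cmod (?S N t))\<^sup>2) / (2 * pi)) \<longlonglongrightarrow>
      (LINT t|circle_measure. (cmod (?F t))\<^sup>2) / (2 * pi)"
    by (intro tendsto_divide tendsto_const dom(1)[OF const AE1 AE2]) auto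
  then show "(\<lambda>n. (cmod (c n))\<^sup>2) sums ((LINT t|circle_measure. (cmod (?F t))\<^sup>2) / (2 * pi))"
    unfolding sums_def parseval_circle_finite by simp
qed

section \<open>Multipliers of the Hardy space\<close>

text \<open>Membership in the Hardy space without the convention of vanishing off the disc, so that
  constants, polynomials and products qualify without truncation.\<close>

definition hardy_class :: "(complex \<Rightarrow> complex) \<Rightarrow> bool" where
  "hardy_class f \<longleftrightarrow> f holomorphic_on unit_disc \<and> summable (\<lambda>n. (cmod (maclaurin_coeff f n))\<^sup>2)"

text \<open>The square of \<open>hardy2_norm\<close>; estimates with squares avoid roots
  throughout.\<close>

definition hardy_sq :: "(complex \<Rightarrow> complex) \<Rightarrow> real" where
  "hardy_sq f = (\<Sum>n. (cmod (maclaurin_coeff f n))\<^sup>2)"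

section \<open>Maclaurin coefficients and linear operations\<close>

lemma maclaurin_coeff_cong:
  assumes "\<And>z. z \<in> unit_disc \<Longrightarrow> f z = g z"
  shows "maclaurin_coeff f n = maclaurin_coeff g n"
proof -
  have "eventually (\<lambda>z. f z = g z) (nhds 0)"
    using assms by (auto simp: eventually_nhds intro!: exI[of _ unit_disc])
  then show ?thesis
    unfolding maclaurin_coeff_def by (subst higher_deriv_cong_ev[of f g 0 0]) auto
qed

lemma hardy_sq_cong:
  assumes "\<And>z. z \<in> unit_disc \<Longrightarrow> f z = g z"
  shows "hardy_sq f = hardy_sq g"
  using maclaurin_coeff_cong[OF assms] by (simp add: hardy_sq_def)

lemma hardy_class_cong:
  assumes "\<And>z. z \<in> unit_disc \<Longrightarrow> f z = g z"
  shows "hardy_class f \<longleftrightarrow> hardy_class g"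
proof -
  have "maclaurin_coeff f = maclaurin_coeff g"
    by (rule ext, rule maclaurin_coeff_cong) (rule assms)
  moreover have "f holomorphic_on unit_disc \<longleftrightarrow> g holomorphic_on unit_disc"
    by (rule holomorphic_cong) (use assms in auto)
  ultimately show ?thesis by (simp add: hardy_class_def)
qed

lemma maclaurin_coeff_diff:
  assumes "f holomorphic_on unit_disc" "g holomorphic_on unit_disc"
  shows "maclaurin_coeff (\<lambda>z. f z - g z) n = maclaurin_coeff f n - maclaurin_coeff g n"
  unfolding maclaurin_coeff_def
  using higher_deriv_diff[OF assms, of 0 n] by (simp add: diff_divide_distrib)

lemma maclaurin_coeff_add:
  assumes "f holomorphic_on unit_disc" "g holomorphic_on unit_disc"
  shows "maclaurin_coeff (\<lambda>z. f z + g z) n = maclaurin_coeff f n + maclaurin_coeff g n"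
  unfolding maclaurin_coeff_def
  using higher_deriv_add[OF assms, of 0 n] by (simp add: add_divide_distrib)

lemma maclaurin_coeff_const:
  "maclaurin_coeff (\<lambda>z. c) n = (if n = 0 then c else 0)"
  by (simp add: maclaurin_coeff_def)

lemma maclaurin_coeff_polynomial:
  "maclaurin_coeff (\<lambda>z. \<Sum>k<K. a k * z ^ k) n = (if n < K then a n else 0)"
proof -
  have "(\<lambda>z. \<Sum>k<K. a k * z ^ k) has_fps_expansion (\<Sum>k<K. fps_const (a k) * fps_X ^ k)"
    by (intro fps_expansion_intros)
  then have "maclaurin_coeff (\<lambda>z. \<Sum>k<K. a k * z ^ k) n =
      fps_nth (\<Sum>k<K. fps_const (a k) * fps_X ^ k) n"
    by (simp add: maclaurin_coeff_def fps_nth_fps_expansion)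
  also have "\<dots> = (\<Sum>k<K. if n = k then a k else 0)"
    by (simp add: fps_sum_nth if_distrib cong: if_cong)
  finally show ?thesis by simp
qed

text \<open>Stands in for the triangle inequality at the level of squares; the factor 2 is harmless
  in limit arguments.\<close>

lemma norm_add_sq_le: "(cmod (x + y))\<^sup>2 \<le> 2 * (cmod x)\<^sup>2 + 2 * (cmod y)\<^sup>2"
proof -
  have "(cmod (x + y))\<^sup>2 \<le> (cmod x + cmod y)\<^sup>2"
    by (intro power_mono norm_triangle_ineq norm_ge_zero)
  moreover have "0 \<le> (cmod x - cmod y)\<^sup>2" by simp
  ultimately show ?thesis by (simp add: power2_eq_square algebra_simps)
qed

lemma hardy_add:
  assumes "hardy_class f" "hardy_class g"
  shows "hardy_class (\<lambda>z. f z + g z)"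
    and "hardy_sq (\<lambda>z. f z + g z) \<le> 2 * hardy_sq f + 2 * hardy_sq g"
proof -
  let ?a = "\<lambda>n. (cmod (maclaurin_coeff f n))\<^sup>2" and ?b = "\<lambda>n. (cmod (maclaurin_coeff g n))\<^sup>2"
  have *: "maclaurin_coeff (\<lambda>z. f z + g z) n = maclaurin_coeff f n + maclaurin_coeff g n" for n
    using assms by (intro maclaurin_coeff_add) (auto simp: hardy_class_def)
  have sm: "summable (\<lambda>n. 2 * ?a n + 2 * ?b n)"
    using assms by (intro summable_add summable_mult) (auto simp: hardy_class_def)
  have sm': "summable (\<lambda>n. (cmod (maclaurin_coeff (\<lambda>z. f z + g z) n))\<^sup>2)"
    by (rule summable_comparison_test'[OF sm]) (simp add: * norm_add_sq_le)
  show "hardy_class (\<lambda>z. f z + g z)"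
    using assms sm' by (auto simp: hardy_class_def intro!: holomorphic_intros)
  have "hardy_sq (\<lambda>z. f z + g z) \<le> (\<Sum>n. 2 * ?a n + 2 * ?b n)"
    unfolding hardy_sq_def by (rule suminf_le[OF _ sm' sm]) (simp add: * norm_add_sq_le)
  also have "\<dots> = 2 * hardy_sq f + 2 * hardy_sq g"
    unfolding hardy_sq_def using assms
    by (simp add: hardy_class_def suminf_mult suminf_add[symmetric] summable_mult)
  finally show "hardy_sq (\<lambda>z. f z + g z) \<le> 2 * hardy_sq f + 2 * hardy_sq g" .
qed

lemma hardy_sq_nonneg: "hardy_class f \<Longrightarrow> 0 \<le> hardy_sq f"
  by (simp add: hardy_class_def hardy_sq_def suminf_nonneg)

lemma hardy_class_const: "hardy_class (\<lambda>z. c)"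
  and hardy_sq_const: "hardy_sq (\<lambda>z. c) = (cmod c)\<^sup>2"
proof -
  have "(\<lambda>n. (cmod (maclaurin_coeff (\<lambda>z. c) n))\<^sup>2) sums (\<Sum>n\<in>{0}. (cmod (maclaurin_coeff (\<lambda>z. c) n))\<^sup>2)"
    by (rule sums_finite) (auto simp: maclaurin_coeff_const)
  then have *: "(\<lambda>n. (cmod (maclaurin_coeff (\<lambda>z. c) n))\<^sup>2) sums (cmod c)\<^sup>2"
    by (simp add: maclaurin_coeff_const)
  show "hardy_class (\<lambda>z. c)"
    using * by (auto simp: hardy_class_def sums_iff)
  show "hardy_sq (\<lambda>z. c) = (cmod c)\<^sup>2"
    using * by (simp add: hardy_sq_def sums_iff)
qed

section \<open>Mean squares on smaller circles and bounded multipliers\<close>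

lemma holomorphic_maclaurin:
  assumes "f holomorphic_on unit_disc" "z \<in> unit_disc"
  shows "(\<lambda>n. maclaurin_coeff f n * z ^ n) sums f z"
  using holomorphic_power_series[OF assms] by (simp add: maclaurin_coeff_def)

text \<open>Parseval's identity for the coefficients of \<open>f\<close> scaled by
  \<open>r ^ n\<close>, which are absolutely summable because the power series converges beyond
  radius r.\<close>

lemma circle_mean_square:
  assumes hol: "f holomorphic_on unit_disc" and r: "0 < r" "r < 1"
  shows "(\<lambda>n. (cmod (maclaurin_coeff f n))\<^sup>2 * r ^ (2 * n)) sums
      ((LINT t|circle_measure. (cmod (f (of_real r * cis t)))\<^sup>2) / (2 * pi))"
    and "integrable circle_measure (\<lambda>t. (cmod (f (of_real r * cis t)))\<^sup>2)"
proof -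
  define c where "c n = maclaurin_coeff f n * of_real r ^ n" for n
  \<comment> \<open>Convergence at the intermediate radius s yields absolute convergence at the
    smaller radius r.\<close>
  obtain s where s: "r < s" "s < 1" using r dense by blast
  have "summable (\<lambda>n. maclaurin_coeff f n * of_real s ^ n)"
    using holomorphic_maclaurin[OF hol, of "of_real s"] s r by (auto simp: sums_iff)
  then have sm: "summable (\<lambda>n. cmod (c n))"
    unfolding c_def by (rule powser_insidea) (use s r in auto)
  have F: "(\<Sum>n. c n * cis (of_nat n * t)) = f (of_real r * cis t)" for t
  proof -
    have "(\<lambda>n. maclaurin_coeff f n * (of_real r * cis t) ^ n) sums f (of_real r * cis t)"
      using r by (intro holomorphic_maclaurin hol) (auto simp: norm_mult)
    then show ?thesis
      by (simp add: c_def power_mult_distrib Complex.DeMoivre mult.assoc sums_iff)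
  qed
  have c2: "(cmod (c n))\<^sup>2 = (cmod (maclaurin_coeff f n))\<^sup>2 * r ^ (2 * n)" for n
    using r by (simp add: c_def norm_mult norm_power power_mult_distrib power_even_eq power_mult[symmetric] mult.commute)
  show "(\<lambda>n. (cmod (maclaurin_coeff f n))\<^sup>2 * r ^ (2 * n)) sums
      ((LINT t|circle_measure. (cmod (f (of_real r * cis t)))\<^sup>2) / (2 * pi))"
    using parseval_circle(1)[OF sm] by (simp add: F c2)
  show "integrable circle_measure (\<lambda>t. (cmod (f (of_real r * cis t)))\<^sup>2)"
    using parseval_circle(2)[OF sm] by (simp add: F)
qed

text \<open>On each circle of radius r < 1 the bound on \<open>u\<close> compares the mean squares
  of \<open>f * u\<close> and \<open>f\<close>; letting r tend to 1 gives the norm estimate.\<close>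

lemma hardy_mult:
  assumes f: "hardy_class f" and u: "u holomorphic_on unit_disc"
    and bd: "\<And>z. z \<in> unit_disc \<Longrightarrow> cmod (u z) \<le> C"
  shows "hardy_class (\<lambda>z. f z * u z)"
    and "hardy_sq (\<lambda>z. f z * u z) \<le> C\<^sup>2 * hardy_sq f"
proof -
  let ?g = "\<lambda>z. f z * u z"
  let ?b = "\<lambda>n. (cmod (maclaurin_coeff ?g n))\<^sup>2" and ?a = "\<lambda>n. (cmod (maclaurin_coeff f n))\<^sup>2"
  have fh: "f holomorphic_on unit_disc" and sa: "summable ?a"
    using f by (auto simp: hardy_class_def)
  have gh: "?g holomorphic_on unit_disc"
    using fh u by (intro holomorphic_intros)
  have C: "C \<ge> 0" using bd[of 0] norm_ge_zero order_trans by (metis centre_in_ball zero_less_one)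
  have partial_r: "(\<Sum>n<N. ?b n * r ^ (2 * n)) \<le> C\<^sup>2 * hardy_sq f" if r: "0 < r" "r < 1" for N r
  proof -
    note G = circle_mean_square[OF gh r] and F = circle_mean_square[OF fh r]
    have "(\<Sum>n<N. ?b n * r ^ (2 * n)) \<le> (\<Sum>n. ?b n * r ^ (2 * n))"
      using G(1) r by (intro sum_le_suminf) (auto simp: sums_iff)
    also have "\<dots> = (LINT t|circle_measure. (cmod (?g (of_real r * cis t)))\<^sup>2) / (2 * pi)"
      using G(1) by (simp add: sums_iff)
    also have "\<dots> \<le> (LINT t|circle_measure. C\<^sup>2 * (cmod (f (of_real r * cis t)))\<^sup>2) / (2 * pi)"
    proof (intro divide_right_mono integral_mono G(2) integrable_mult_right F(2))
      fix t
      have "(cmod (u (of_real r * cis t)))\<^sup>2 \<le> C\<^sup>2"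
        using r by (intro power_mono bd norm_ge_zero) (auto simp: norm_mult)
      then show "(cmod (?g (of_real r * cis t)))\<^sup>2 \<le> C\<^sup>2 * (cmod (f (of_real r * cis t)))\<^sup>2"
        by (simp add: norm_mult power_mult_distrib mult.commute[of "C\<^sup>2"] mult_left_mono)
    qed auto
    also have "\<dots> = C\<^sup>2 * (\<Sum>n. ?a n * r ^ (2 * n))"
      using F(1) by (simp add: sums_iff)
    also have "\<dots> \<le> C\<^sup>2 * hardy_sq f"
      unfolding hardy_sq_def
    proof (intro mult_left_mono suminf_le sa)
      show "?a n * r ^ (2 * n) \<le> ?a n" for n
        using r by (intro mult_left_le power_le_one) auto
      show "summable (\<lambda>n. ?a n * r ^ (2 * n))" using F(1) by (simp add: sums_iff)
    qed auto
    finally show ?thesis .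
  qed
  \<comment> \<open>A finite partial sum is a polynomial in r, so the limit at 1 is immediate. The
    resulting uniform bound yields summability as well as the estimate.\<close>
  have partial: "(\<Sum>n<N. ?b n) \<le> C\<^sup>2 * hardy_sq f" for N
  proof (rule tendsto_upperbound)
    have "((\<lambda>r. \<Sum>n<N. ?b n * r ^ (2 * n)) \<longlongrightarrow> (\<Sum>n<N. ?b n * 1 ^ (2 * n))) (at_left (1::real))"
      by (intro tendsto_intros)
    then show "((\<lambda>r. \<Sum>n<N. ?b n * r ^ (2 * n)) \<longlongrightarrow> (\<Sum>n<N. ?b n)) (at_left (1::real))"
      by simp
    show "\<forall>\<^sub>F r in at_left (1::real). (\<Sum>n<N. ?b n * r ^ (2 * n)) \<le> C\<^sup>2 * hardy_sq f"
      using eventually_at_left_real[of 0 1] by (auto elim!: eventually_mono intro!: partial_r)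
  qed auto
  have sb: "summable ?b"
    by (rule summableI_nonneg_bounded[OF _ partial]) auto
  show "hardy_class ?g" using gh sb by (simp add: hardy_class_def)
  show "hardy_sq ?g \<le> C\<^sup>2 * hardy_sq f"
    unfolding hardy_sq_def[of ?g] by (rule suminf_le_const[OF sb partial])
qed

lemma hardy_bounded:
  assumes "u holomorphic_on unit_disc" "\<And>z. z \<in> unit_disc \<Longrightarrow> cmod (u z) \<le> C"
  shows "hardy_class u" "hardy_sq u \<le> C\<^sup>2"
  using hardy_mult[OF hardy_class_const assms, of 1] by (simp_all add: hardy_sq_const)

lemma hardy_diff:
  assumes "hardy_class f" "hardy_class g"
  shows "hardy_class (\<lambda>z. f z - g z)"
    and "hardy_sq (\<lambda>z. f z - g z) \<le> 2 * hardy_sq f + 2 * hardy_sq g"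
proof -
  have g: "hardy_class (\<lambda>z. g z * (-1))" "hardy_sq (\<lambda>z. g z * (-1)) \<le> 1\<^sup>2 * hardy_sq g"
    by (rule hardy_mult[OF assms(2)]; auto)+
  show "hardy_class (\<lambda>z. f z - g z)" "hardy_sq (\<lambda>z. f z - g z) \<le> 2 * hardy_sq f + 2 * hardy_sq g"
    using hardy_add[OF assms(1) g(1)] g(2) by simp_all
qed

section \<open>Polynomial approximation and strong convergence of multipliers\<close>

lemma polynomial_bounded_on_disc:
  fixes a :: "nat \<Rightarrow> complex"
  assumes "z \<in> unit_disc"
  shows "cmod (\<Sum>k<K. a k * z ^ k) \<le> (\<Sum>k<K. cmod (a k))"
proof (rule order_trans[OF norm_sum], rule sum_mono)
  show "cmod (a k * z ^ k) \<le> cmod (a k)" for k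
    using assms by (simp add: norm_mult norm_power mult_left_le power_le_one)
qed

text \<open>Truncating the Maclaurin series leaves exactly the tail of a convergent series as
  error.\<close>

lemma hardy_polynomial_approx:
  assumes g: "hardy_class g" and e: "e > 0"
  obtains a K where "hardy_sq (\<lambda>z. g z - (\<Sum>k<K. a k * z ^ k)) < e"
proof -
  let ?m = "maclaurin_coeff g"
  have sm: "summable (\<lambda>n. (cmod (?m n))\<^sup>2)" using g by (simp add: hardy_class_def)
  obtain K where K: "norm (\<Sum>i. (cmod (?m (i + K)))\<^sup>2) < e"
    using suminf_exist_split[OF e sm] by blast
  have coeff: "maclaurin_coeff (\<lambda>z. g z - (\<Sum>k<K. ?m k * z ^ k)) n = (if n < K then 0 else ?m n)" for n
    using g by (subst maclaurin_coeff_diff)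
       (auto simp: hardy_class_def maclaurin_coeff_polynomial intro!: holomorphic_intros)
  let ?t = "\<lambda>n. (cmod (if n < K then 0 else ?m n))\<^sup>2"
  have st: "summable ?t"
    by (rule summable_comparison_test'[OF sm]) auto
  have "hardy_sq (\<lambda>z. g z - (\<Sum>k<K. ?m k * z ^ k)) = (\<Sum>n. ?t n)"
    by (simp add: hardy_sq_def coeff)
  also have "\<dots> = (\<Sum>i. ?t (i + K)) + (\<Sum>i<K. ?t i)"
    by (rule suminf_split_initial_segment[OF st])
  also have "\<dots> = (\<Sum>i. (cmod (?m (i + K)))\<^sup>2)" by simp
  finally have "hardy_sq (\<lambda>z. g z - (\<Sum>k<K. ?m k * z ^ k)) < e" using K by auto
  then show ?thesis using that by blast
qed

text \<open>Only convergence at the origin is needed: among functions bounded by 1, one whose constant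
  coefficient is nearly unimodular has almost no mass left for the other coefficients.\<close>

lemma hardy_sq_diff_const_le:
  assumes "v holomorphic_on unit_disc" "\<And>z. z \<in> unit_disc \<Longrightarrow> cmod (v z) \<le> 1"
  shows "hardy_sq (\<lambda>z. v z - c) \<le> 1 - (cmod (v 0))\<^sup>2 + (cmod (v 0 - c))\<^sup>2"
proof -
  let ?m = "\<lambda>n. (cmod (maclaurin_coeff v n))\<^sup>2"
  let ?d = "\<lambda>n. (cmod (maclaurin_coeff (\<lambda>z. v z - c) n))\<^sup>2"
  have v: "hardy_class v" "hardy_sq v \<le> 1" using hardy_bounded[OF assms] by auto
  have sm: "summable ?m" "summable ?d"
    using v(1) hardy_diff(1)[OF v(1) hardy_class_const, of c] by (auto simp: hardy_class_def)
  have coeff: "maclaurin_coeff (\<lambda>z. v z - c) n = maclaurin_coeff v n - (if n = 0 then c else 0)" for n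
    using assms by (subst maclaurin_coeff_diff) (auto simp: maclaurin_coeff_const)
  have [simp]: "maclaurin_coeff v 0 = v 0" by (simp add: maclaurin_coeff_def)
  have "hardy_sq (\<lambda>z. v z - c) = (cmod (v 0 - c))\<^sup>2 + (\<Sum>n. ?m (Suc n))"
    unfolding hardy_sq_def using suminf_split_head[OF sm(2)] by (simp add: coeff)
  moreover have "hardy_sq v = (cmod (v 0))\<^sup>2 + (\<Sum>n. ?m (Suc n))"
    unfolding hardy_sq_def using suminf_split_head[OF sm(1)] by simp
  ultimately show ?thesis using v(2) by simp
qed

text \<open>Applied to the constant 1, the multipliers \<open>v n\<close> converge to c by the
  preceding estimate, since |v_n(0)| tends to 1. This extends to polynomials, which are bounded, and
  then to all \<open>g\<close> by density, because \<open>v n - c\<close> is bounded by 2 uniformly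
  in n.\<close>

lemma hardy_contractive_multipliers_tendsto:
  assumes g: "hardy_class g"
    and hol: "\<And>n. v n holomorphic_on unit_disc"
    and bd: "\<And>n z. z \<in> unit_disc \<Longrightarrow> cmod (v n z) \<le> 1"
    and lim: "(\<lambda>n. v n 0) \<longlonglongrightarrow> c" and c: "cmod c = 1"
  shows "(\<lambda>n. hardy_sq (\<lambda>z. g z * (v n z - c))) \<longlonglongrightarrow> 0"
proof (rule LIMSEQ_I)
  fix e :: real assume e: "e > 0"
  \<comment> \<open>The tolerance e/16 is multiplied by 2 from \<open>hardy_add\<close> and by 4
    from the bound 2 on \<open>v n - c\<close>, so it contributes e/2.\<close>
  obtain a K where aK: "hardy_sq (\<lambda>z. g z - (\<Sum>k<K. a k * z ^ k)) < e / 16"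
    using hardy_polynomial_approx[OF g, of "e / 16"] e by auto
  define p where "p z = (\<Sum>k<K. a k * z ^ k)" for z
  define B where "B = (\<Sum>k<K. cmod (a k))"
  have p: "p holomorphic_on unit_disc" "\<And>z. z \<in> unit_disc \<Longrightarrow> cmod (p z) \<le> B"
    unfolding p_def B_def by (auto intro!: holomorphic_intros polynomial_bounded_on_disc)
  have gp: "hardy_class (\<lambda>z. g z - p z)" "hardy_sq (\<lambda>z. g z - p z) < e / 16"
    using hardy_diff(1)[OF g hardy_bounded(1)[OF p]] aK by (auto simp: p_def)
  have vc: "(\<lambda>z. v n z - c) holomorphic_on unit_disc"
    "\<And>z. z \<in> unit_disc \<Longrightarrow> cmod (v n z - c) \<le> 2" for n
    using hol[of n] norm_triangle_ineq4[of "v n z" c for z] bd[of _ n] c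
    by (auto intro!: holomorphic_intros) (smt (verit) mem_ball_0)
  have le: "hardy_class (\<lambda>z. g z * (v n z - c))"
    "hardy_sq (\<lambda>z. g z * (v n z - c)) \<le>
      2 * B\<^sup>2 * (1 - (cmod (v n 0))\<^sup>2 + (cmod (v n 0 - c))\<^sup>2) + e / 2" for n
  proof -
    note A = hardy_mult[OF hardy_bounded(1)[OF vc] p, of n]
    note D = hardy_mult[OF gp(1) vc, of n]
    \<comment> \<open>The roles differ in the two terms: \<open>p\<close> is the bounded multiplier
      in the first, \<open>v n - c\<close> in the second.\<close>
    have split: "(\<lambda>z. (v n z - c) * p z + (g z - p z) * (v n z - c)) = (\<lambda>z. g z * (v n z - c))"
      by (auto simp: algebra_simps)
    show "hardy_class (\<lambda>z. g z * (v n z - c))"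
      using hardy_mult(1)[OF g vc] .
    have "hardy_sq (\<lambda>z. g z * (v n z - c)) \<le>
        2 * hardy_sq (\<lambda>z. (v n z - c) * p z) + 2 * hardy_sq (\<lambda>z. (g z - p z) * (v n z - c))"
      using hardy_add(2)[OF A(1) D(1)] unfolding split .
    also have "\<dots> \<le> 2 * (B\<^sup>2 * hardy_sq (\<lambda>z. v n z - c)) + 2 * (2\<^sup>2 * hardy_sq (\<lambda>z. g z - p z))"
      using A(2) D(2) by simp
    also have "\<dots> \<le> 2 * (B\<^sup>2 * (1 - (cmod (v n 0))\<^sup>2 + (cmod (v n 0 - c))\<^sup>2)) + 2 * (2\<^sup>2 * (e / 16))"
      using gp(2) hardy_sq_diff_const_le[OF hol bd, where c=c]
      by (intro add_mono mult_left_mono) auto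
    finally show "hardy_sq (\<lambda>z. g z * (v n z - c)) \<le>
      2 * B\<^sup>2 * (1 - (cmod (v n 0))\<^sup>2 + (cmod (v n 0 - c))\<^sup>2) + e / 2" by simp
  qed
  have "(\<lambda>n. 2 * B\<^sup>2 * (1 - (cmod (v n 0))\<^sup>2 + (cmod (v n 0 - c))\<^sup>2) + e / 2) \<longlonglongrightarrow>
      2 * B\<^sup>2 * (1 - (cmod c)\<^sup>2 + (cmod (c - c))\<^sup>2) + e / 2"
    by (intro tendsto_intros lim)
  then have "(\<lambda>n. 2 * B\<^sup>2 * (1 - (cmod (v n 0))\<^sup>2 + (cmod (v n 0 - c))\<^sup>2) + e / 2) \<longlonglongrightarrow> e / 2"
    using c by simp
  then have "\<forall>\<^sub>F n in sequentially. 2 * B\<^sup>2 * (1 - (cmod (v n 0))\<^sup>2 + (cmod (v n 0 - c))\<^sup>2) + e / 2 < e"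
    by (rule order_tendstoD) (use e in auto)
  then have "\<forall>\<^sub>F n in sequentially. norm (hardy_sq (\<lambda>z. g z * (v n z - c)) - 0) < e"
  proof eventually_elim
    case (elim n)
    then show ?case using le(2)[of n] hardy_sq_nonneg[OF le(1)[of n]] by simp
  qed
  then show "\<exists>N. \<forall>n\<ge>N. norm (hardy_sq (\<lambda>z. g z * (v n z - c)) - 0) < e"
    by (simp add: eventually_sequentially)
qed

section \<open>Outer functions\<close>

text \<open>The Herglotz integral from the definition of \<open>outer_function\<close>, without its
  factor 1/(2 pi).\<close>

definition herglotz :: "(real \<Rightarrow> real) \<Rightarrow> complex \<Rightarrow> complex" where
  "herglotz k z = (LINT t|circle_measure. (cis t + z) / (cis t - z) * of_real (k t))"

lemma integrable_circle_mult_bounded: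
  fixes h :: "real \<Rightarrow> complex"
  assumes k: "integrable circle_measure k" and h: "h \<in> borel_measurable borel"
    and bd: "\<And>t. cmod (h t) \<le> B"
  shows "integrable circle_measure (\<lambda>t. h t * of_real (k t))"
proof (rule Bochner_Integration.integrable_bound)
  show "integrable circle_measure (\<lambda>t. B * k t)" using k by simp
  show "(\<lambda>t. h t * of_real (k t)) \<in> borel_measurable circle_measure"
    using borel_measurable_circle[OF h] k by (auto intro!: borel_measurable_times)
  have "B \<ge> 0" using bd norm_ge_zero order_trans by blast
  then show "AE t in circle_measure. norm (h t * of_real (k t)) \<le> norm (B * k t)"
    using bd by (intro always_eventually) (auto simp: norm_mult abs_mult intro!: mult_right_mono)
qed

lemma norm_cis_diff_ge: "1 - cmod z \<le> cmod (cis t - z)"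
  using norm_triangle_ineq2[of "cis t" z] by simp

lemma herglotz_kernel_integrable:
  assumes k: "integrable circle_measure k" and z: "z \<in> unit_disc"
  shows "integrable circle_measure (\<lambda>t. (cis t + z) / (cis t - z) * of_real (k t))"
proof (rule integrable_circle_mult_bounded[OF k])
  show "cmod ((cis t + z) / (cis t - z)) \<le> 2 / (1 - cmod z)" for t
    unfolding norm_divide using z norm_cis_diff_ge[of z t] norm_triangle_ineq[of "cis t" z]
    by (intro frac_le) auto
qed measurable

lemma herglotz_kernel_eq:
  assumes "z \<in> unit_disc"
  shows "(cis t + z) / (cis t - z) = 2 * (1 / (1 - z * cis (- t))) - 1"
proof -
  have "cis t \<noteq> z" using assms by auto
  then show ?thesis by (simp add: field_simps flip: cis_inverse)
qed

text \<open>The kernel is expanded in powers of z and integrated term by term. The n-th term has L1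
  norm |z|^n times that of \<open>k\<close>, so the interchange is legitimate and a power series on
  the disc results.\<close>

lemma herglotz_holomorphic:
  assumes k: "integrable circle_measure k"
  shows "herglotz k holomorphic_on unit_disc"
proof -
  \<comment> \<open>The Cauchy transform of \<open>k\<close>: its kernel is the sum of a geometric
    series, and the Herglotz kernel is twice this kernel minus 1.\<close>
  define J where "J z = (LINT t|circle_measure. (1 / (1 - z * cis (- t))) * of_real (k t))" for z
  have J: "(\<lambda>n. (LINT t|circle_measure. cis (- t) ^ n * of_real (k t)) * (z - 0) ^ n) sums J z"
    and H: "herglotz k z = 2 * J z - (LINT t|circle_measure. of_real (k t))"
    if z: "z \<in> unit_disc" for z
  proof -
    let ?s = "\<lambda>n t. (z * cis (- t)) ^ n * of_real (k t)"
    have z1: "cmod z < 1" using z by simp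
    have int: "integrable circle_measure (?s n)" for n
      using z1 by (intro integrable_circle_mult_bounded[OF k, where B=1])
        (auto simp: norm_mult norm_power power_le_one)
    have ns: "norm (?s n t) = cmod z ^ n * \<bar>k t\<bar>" for n t
      by (simp add: norm_mult norm_power)
    have geo: "(\<Sum>n. ?s n t) = (1 / (1 - z * cis (- t))) * of_real (k t)" for t
    proof -
      have "(\<lambda>n. (z * cis (- t)) ^ n) sums (1 / (1 - z * cis (- t)))"
        using z1 by (intro geometric_sums) (simp add: norm_mult)
      from sums_mult2[OF this] show ?thesis by (simp add: sums_iff)
    qed
    have sm: "AE t in circle_measure. summable (\<lambda>n. norm (?s n t))"
      using z1 unfolding ns by (intro always_eventually allI summable_mult2 summable_geometric) auto
    have sm': "summable (\<lambda>n. LINT t|circle_measure. norm (?s n t))"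
      using z1 unfolding ns by (simp add: summable_mult2 summable_geometric)
    have "(\<lambda>n. integral\<^sup>L circle_measure (?s n)) sums J z"
      using sums_integral[OF int sm sm'] unfolding geo J_def .
    moreover have "integral\<^sup>L circle_measure (?s n) =
        (LINT t|circle_measure. cis (- t) ^ n * of_real (k t)) * (z - 0) ^ n" for n
      unfolding power_mult_distrib
      by (subst mult.commute, subst integral_mult_right_zero[symmetric]) (simp add: mult_ac)
    ultimately show "(\<lambda>n. (LINT t|circle_measure. cis (- t) ^ n * of_real (k t)) * (z - 0) ^ n) sums J z"
      by simp
    have intJ: "integrable circle_measure (\<lambda>t. (1 / (1 - z * cis (- t))) * of_real (k t))"
      using integrable_suminf[OF int sm sm'] unfolding geo .
    have intk: "integrable circle_measure (\<lambda>t. complex_of_real (k t))"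
      using k by simp
    have "herglotz k z = (LINT t|circle_measure.
        2 * ((1 / (1 - z * cis (- t))) * of_real (k t)) - of_real (k t))"
      unfolding herglotz_def herglotz_kernel_eq[OF z] by (simp add: left_diff_distrib mult.assoc)
    also have "\<dots> = 2 * J z - (LINT t|circle_measure. of_real (k t))"
      unfolding J_def
      by (subst Bochner_Integration.integral_diff[OF integrable_mult_right[OF intJ] intk])
         (simp only: integral_mult_right_zero)
    finally show "herglotz k z = 2 * J z - (LINT t|circle_measure. of_real (k t))" .
  qed
  have "J holomorphic_on unit_disc"
    by (rule power_series_holomorphic[OF J])
  then have "(\<lambda>z. 2 * J z - (LINT t|circle_measure. of_real (k t))) holomorphic_on unit_disc"
    by (intro holomorphic_intros)
  then show ?thesis
    by (rule holomorphic_transform) (simp add: H)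
qed

lemma herglotz_add:
  assumes "integrable circle_measure k" "integrable circle_measure l" "z \<in> unit_disc"
  shows "herglotz (\<lambda>t. k t + l t) z = herglotz k z + herglotz l z"
  unfolding herglotz_def
  using herglotz_kernel_integrable[OF assms(1,3)] herglotz_kernel_integrable[OF assms(2,3)]
  by (simp add: distrib_left)

lemma herglotz_at_0: "herglotz k 0 = of_real (integral\<^sup>L circle_measure k)"
  by (simp add: herglotz_def)

section \<open>The Poisson kernel and upper bounds for real parts\<close>

definition poisson :: "complex \<Rightarrow> real \<Rightarrow> real" where
  "poisson z t = (1 - (cmod z)\<^sup>2) / (cmod (cis t - z))\<^sup>2"

lemma poisson_nonneg: "z \<in> unit_disc \<Longrightarrow> 0 \<le> poisson z t"
  by (simp add: poisson_def power_le_one)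

lemma Re_herglotz_kernel: "Re ((cis t + z) / (cis t - z)) = poisson z t"
proof -
  have "Re ((cis t + z) * cnj (cis t - z)) = (cmod (cis t))\<^sup>2 - (cmod z)\<^sup>2"
    unfolding cmod_power2 by (simp add: power2_eq_square algebra_simps)
  then show ?thesis
    unfolding poisson_def complex_div_cnj[of "cis t + z"] by (simp flip: of_real_power)
qed

text \<open>Up to the factor 1 - |z|^2, the Poisson kernel is the squared modulus of a geometric
  series in \<open>cis t\<close> with coefficients \<open>cnj z ^ n\<close>. Parseval's identity
  gives its mean square as 1/(1 - |z|^2).\<close>

lemma integral_poisson:
  assumes z: "z \<in> unit_disc"
  shows "integral\<^sup>L circle_measure (poisson z) = 2 * pi"
    and "integrable circle_measure (poisson z)"
proof -
  have z1: "cmod z < 1" using z by simp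
  have F: "(\<Sum>n. cnj z ^ n * cis (of_nat n * t)) = 1 / (1 - cnj z * cis t)" for t
  proof -
    have "(\<lambda>n. (cnj z * cis t) ^ n) sums (1 / (1 - cnj z * cis t))"
      using z1 by (intro geometric_sums) (simp add: norm_mult)
    then show ?thesis by (simp add: sums_iff power_mult_distrib Complex.DeMoivre)
  qed
  \<comment> \<open>Conjugating and multiplying by the unimodular number \<open>cis t\<close> turns
    one denominator into the other.\<close>
  have n: "cmod (1 - cnj z * cis t) = cmod (cis t - z)" for t
  proof -
    have "cis t * cnj (1 - cnj z * cis t) = cis t - z"
      by (simp add: cis_cnj right_diff_distrib cis_mult mult.left_commute[of "cis t"])
    then have "cmod (cis t - z) = cmod (cis t) * cmod (cnj (1 - cnj z * cis t))"
      by (simp only: norm_mult[symmetric])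
    then show ?thesis by (simp only: complex_mod_cnj norm_cis mult_1)
  qed
  have P: "poisson z = (\<lambda>t. (1 - (cmod z)\<^sup>2) * (cmod (\<Sum>n. cnj z ^ n * cis (of_nat n * t)))\<^sup>2)"
    unfolding F by (auto simp: poisson_def norm_divide n power_divide)
  have sm: "summable (\<lambda>n. cmod (cnj z ^ n))"
    using z1 by (simp add: norm_power summable_geometric)
  note pars = parseval_circle[OF sm]
  show "integrable circle_measure (poisson z)"
    unfolding P by (intro integrable_mult_right pars(2))
  have zz: "(cmod z)\<^sup>2 < 1" using z1 by (simp add: power_less_one_iff)
  have "(\<lambda>n. ((cmod z)\<^sup>2) ^ n) sums (1 / (1 - (cmod z)\<^sup>2))"
    using zz by (intro geometric_sums) simp
  then have "(\<lambda>n. (cmod (cnj z ^ n))\<^sup>2) sums (1 / (1 - (cmod z)\<^sup>2))"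
    by (simp add: norm_power power_mult[symmetric] mult.commute)
  from sums_unique2[OF this pars(1)] zz
  have "(LINT t|circle_measure. (cmod (\<Sum>n. cnj z ^ n * cis (of_nat n * t)))\<^sup>2) =
      2 * pi / (1 - (cmod z)\<^sup>2)"
    by (simp add: field_simps)
  then show "integral\<^sup>L circle_measure (poisson z) = 2 * pi"
    unfolding P integral_mult_right_zero using zz by simp
qed

text \<open>The real part integrates \<open>k\<close> against a nonnegative kernel of mass 2 pi.
  Only a bound from above is involved, as the log-moduli to which this applies may be unbounded
  below.\<close>

lemma Re_herglotz_le:
  assumes k: "integrable circle_measure k" and z: "z \<in> unit_disc" and m: "\<And>t. k t \<le> m"
  shows "Re (herglotz k z) \<le> 2 * pi * m"
proof -
  note int = herglotz_kernel_integrable[OF k z]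
  have eq: "Re ((cis t + z) / (cis t - z) * of_real (k t)) = poisson z t * k t" for t
    unfolding Re_herglotz_kernel[symmetric] times_complex.sel by simp
  have "integrable circle_measure (\<lambda>t. poisson z t * k t)"
    using integrable_Re[OF int] unfolding eq .
  then have "(LINT t|circle_measure. poisson z t * k t) \<le> (LINT t|circle_measure. poisson z t * m)"
    using m poisson_nonneg[OF z] integral_poisson(2)[OF z]
    by (intro integral_mono) (auto intro: mult_left_mono)
  moreover have "Re (herglotz k z) = (LINT t|circle_measure. poisson z t * k t)"
    unfolding herglotz_def using integral_Re[OF int] unfolding eq by simp
  ultimately show ?thesis
    using integral_poisson(1)[OF z] by simp
qed

text \<open>The multipliers are the outer functions with log-modulus \<open>min n (-k)\<close>, where \<open>k\<close> is the
  log-modulus of \<open>f\<close>.\<close>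

lemma outer_function_bounded_inverse_approx:
  assumes "outer_function f"
  obtains c :: complex and u :: "nat \<Rightarrow> complex \<Rightarrow> complex" and B :: "nat \<Rightarrow> real" where
    "cmod c = 1" "\<And>n. u n holomorphic_on unit_disc"
    "\<And>n z. z \<in> unit_disc \<Longrightarrow> cmod (u n z) \<le> B n"
    "\<And>n z. z \<in> unit_disc \<Longrightarrow> cmod (f z * u n z) \<le> 1"
    "(\<lambda>n. f 0 * u n 0) \<longlonglongrightarrow> c"
proof -
  from assms obtain c k where c: "cmod c = 1" and k: "set_integrable lborel {0..2 * pi} k"
    and f: "\<And>z. z \<in> unit_disc \<Longrightarrow> f z = c * exp (1 / (2 * of_real pi) *
             (LINT t:{0..2 * pi}|lborel. (cis t + z) / (cis t - z) * of_real (k t)))"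
    unfolding outer_function_def by blast
  have ik: "integrable circle_measure k"
    using k by (subst integrable_restrict_space) (auto simp: set_integrable_def)
  \<comment> \<open>\<open>e l\<close> is the outer function with log-modulus \<open>l\<close> and
    constant factor 1.\<close>
  define e where "e l z = exp (1 / (2 * of_real pi) * herglotz l z)" for l z
  have fe: "f z = c * e k z" if "z \<in> unit_disc" for z
    unfolding f[OF that] e_def herglotz_def set_lebesgue_integral_def
    by (subst integral_restrict_space) auto
  have e_hol: "e l holomorphic_on unit_disc" if "integrable circle_measure l" for l
    unfolding e_def using herglotz_holomorphic[OF that] by (intro holomorphic_intros)
  have e_le: "cmod (e l z) \<le> exp m"
    if "integrable circle_measure l" "z \<in> unit_disc" "\<And>t. l t \<le> m" for l z m
  proof -
    have "1 / (2 * of_real pi) * herglotz l z = of_real (1 / (2 * pi)) * herglotz l z"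
      by simp
    then have "cmod (e l z) = exp (1 / (2 * pi) * Re (herglotz l z))"
      unfolding e_def norm_exp_eq_Re times_complex.sel Re_complex_of_real Im_complex_of_real by simp
    also have "1 / (2 * pi) * Re (herglotz l z) \<le> m"
      using Re_herglotz_le[OF that] by (simp add: field_simps)
    finally show ?thesis by simp
  qed
  define l where "l n t = min (real n) (- k t)" for n t
  have il: "integrable circle_measure (l n)" for n
    unfolding l_def using ik by (intro integrable_min integrable_circle_bounded[OF _ order_refl]) auto
  \<comment> \<open>This form shows three things: the sum is nonpositive, so the product with
    \<open>f\<close> is bounded by 1; it vanishes once n \<ge> - k t; and its modulus is at most
    that of \<open>k t\<close>.\<close>
  have lk: "k t + l n t = min (k t + real n) 0" for n t by (simp add: l_def min_def)
  have fu: "f z * e (l n) z = c * e (\<lambda>t. k t + l n t) z" if "z \<in> unit_disc" for n z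
    unfolding fe[OF that] e_def herglotz_add[OF ik il that] by (simp add: exp_add distrib_left)
  have ikl: "integrable circle_measure (\<lambda>t. k t + l n t)" for n
    using ik il by simp
  \<comment> \<open>At the origin the Herglotz integral is the plain integral, so dominated
    convergence with majorant |k| gives the limit of the values there.\<close>
  have lim0: "(\<lambda>n. LINT t|circle_measure. k t + l n t) \<longlonglongrightarrow> (LINT t|circle_measure. 0)"
  proof (rule integral_dominated_convergence[where w="\<lambda>t. \<bar>k t\<bar>"])
    show "AE t in circle_measure. (\<lambda>n. k t + l n t) \<longlonglongrightarrow> 0"
    proof (rule AE_I2, rule tendsto_eventually)
      fix t
      obtain N where "- k t \<le> real N" using real_arch_simple by blast
      then show "\<forall>\<^sub>F n in sequentially. k t + l n t = 0"
        unfolding lk eventually_sequentially by (intro exI[of _ N]) auto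
    qed
    show "AE t in circle_measure. norm (k t + l n t) \<le> \<bar>k t\<bar>" for n
      unfolding lk by (intro always_eventually) auto
  qed (use ik ikl in \<open>auto intro: borel_measurable_integrable\<close>)
  have "(\<lambda>n. c * exp (1 / (2 * of_real pi) * of_real (LINT t|circle_measure. k t + l n t)))
      \<longlonglongrightarrow> c * exp (1 / (2 * of_real pi) * of_real (LINT t|circle_measure. 0))"
    by (intro tendsto_intros lim0)
  moreover have "f 0 * e (l n) 0 =
      c * exp (1 / (2 * of_real pi) * of_real (LINT t|circle_measure. k t + l n t))" for n
    by (subst fu) (simp_all only: e_def herglotz_at_0 centre_in_ball zero_less_one)
  ultimately have lim: "(\<lambda>n. f 0 * e (l n) 0) \<longlonglongrightarrow> c"
    by simp
  show ?thesis
  proof (rule that[where u="\<lambda>n. e (l n)" and B="\<lambda>n. exp (real n)", OF c _ _ _ lim])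
    show "cmod (e (l n) z) \<le> exp (real n)" if "z \<in> unit_disc" for n z
      by (rule e_le[OF il that]) (simp add: l_def)
    show "cmod (f z * e (l n) z) \<le> 1" if "z \<in> unit_disc" for n z
      unfolding fu[OF that] using e_le[OF ikl that, of n 0] c by (simp add: norm_mult lk)
  qed (rule e_hol[OF il])
qed

section \<open>Approximation from the range\<close>

text \<open>Expresses that \<open>g\<close> lies in the closure of \<open>S\<close>. Values of
  \<open>g\<close> off the disc are invisible to \<open>hardy_sq\<close>, so products need no
  truncation.\<close>

definition hardy_approximable :: "(complex \<Rightarrow> complex) set \<Rightarrow> (complex \<Rightarrow> complex) \<Rightarrow> bool" where
  "hardy_approximable S g \<longleftrightarrow> (\<forall>e>0. \<exists>h \<in> S \<inter> hardy2. hardy_sq (\<lambda>z. h z - g z) < e)"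

lemma hardy2_iff: "f \<in> hardy2 \<longleftrightarrow> hardy_class f \<and> (\<forall>z. z \<notin> unit_disc \<longrightarrow> f z = 0)"
  by (auto simp: hardy2_def hardy_class_def)

lemma dense_in_hardy2_iff:
  "dense_in_hardy2 S \<longleftrightarrow> (\<forall>g \<in> hardy2. hardy_approximable S g)"
proof
  assume S: "dense_in_hardy2 S"
  show "\<forall>g \<in> hardy2. hardy_approximable S g"
    unfolding hardy_approximable_def
  proof (intro ballI allI impI)
    fix g and e :: real assume "g \<in> hardy2" "e > 0"
    then obtain h where h: "h \<in> S \<inter> hardy2" "hardy2_norm (\<lambda>z. h z - g z) < sqrt e"
      using S unfolding dense_in_hardy2_def by (metis real_sqrt_gt_0_iff)
    then show "\<exists>h \<in> S \<inter> hardy2. hardy_sq (\<lambda>z. h z - g z) < e"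
      by (auto simp: hardy2_norm_def hardy_sq_def)
  qed
next
  assume A: "\<forall>g \<in> hardy2. hardy_approximable S g"
  show "dense_in_hardy2 S"
    unfolding dense_in_hardy2_def
  proof (intro ballI allI impI)
    fix g and e :: real assume ge: "g \<in> hardy2" "e > 0"
    then have "e\<^sup>2 > 0" by simp
    then obtain h where h: "h \<in> S \<inter> hardy2" "hardy_sq (\<lambda>z. h z - g z) < e\<^sup>2"
      using A ge(1) unfolding hardy_approximable_def by blast
    then have "hardy2_norm (\<lambda>z. h z - g z) < e"
      using ge(2) unfolding hardy2_norm_def hardy_sq_def by (intro real_less_lsqrt) auto
    with h(1) show "\<exists>h \<in> S \<inter> hardy2. hardy2_norm (\<lambda>z. h z - g z) < e" by blast
  qed
qed

text \<open>The closure is closed: two errors below e/4, each doubled by \<open>hardy_add\<close>,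
  sum to less than e.\<close>

lemma hardy_approximable_closed:
  assumes g: "hardy_class g"
    and approx: "\<And>e. e > 0 \<Longrightarrow>
      \<exists>g'. hardy_class g' \<and> hardy_approximable S g' \<and> hardy_sq (\<lambda>z. g' z - g z) < e"
  shows "hardy_approximable S g"
  unfolding hardy_approximable_def
proof (intro allI impI)
  fix e :: real assume e: "e > 0"
  obtain g' where g': "hardy_class g'" "hardy_approximable S g'" "hardy_sq (\<lambda>z. g' z - g z) < e / 4"
    using approx[of "e / 4"] e by auto
  obtain h where h: "h \<in> S \<inter> hardy2" "hardy_sq (\<lambda>z. h z - g' z) < e / 4"
    using g'(2) e unfolding hardy_approximable_def by (meson divide_pos_pos zero_less_numeral)
  have "hardy_class h" using h(1) by (auto simp: hardy2_iff)
  then have "hardy_sq (\<lambda>z. (h z - g' z) + (g' z - g z)) \<le>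
      2 * hardy_sq (\<lambda>z. h z - g' z) + 2 * hardy_sq (\<lambda>z. g' z - g z)"
    using g g'(1) by (intro hardy_add(2) hardy_diff(1))
  then have "hardy_sq (\<lambda>z. h z - g z) < e" using h(2) g'(3) by simp
  with h(1) show "\<exists>h \<in> S \<inter> hardy2. hardy_sq (\<lambda>z. h z - g z) < e" by blast
qed

section \<open>Iterates of the selfmap and the telescoping argument\<close>

lemma analytic_selfmap_funpow:
  assumes "analytic_selfmap \<phi>"
  shows "analytic_selfmap (\<phi> ^^ n)"
proof (induction n)
  case 0
  then show ?case by (auto simp: analytic_selfmap_def intro!: holomorphic_intros)
next
  case (Suc n)
  have "\<phi> \<circ> (\<phi> ^^ n) holomorphic_on unit_disc"
    using Suc assms unfolding analytic_selfmap_def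
    by (intro holomorphic_on_compose_gen[where t=unit_disc]) auto
  moreover have "(\<phi> \<circ> (\<phi> ^^ n)) ` unit_disc \<subseteq> unit_disc"
    using Suc assms unfolding analytic_selfmap_def image_comp[symmetric] by blast
  ultimately show ?case
    unfolding analytic_selfmap_def funpow.simps(2) by blast
qed

lemma composition_op_range_approximates:
  assumes \<phi>: "analytic_selfmap \<phi>"
    and \<omega>: "(\<lambda>n. (\<phi> ^^ n) 0) \<longlonglongrightarrow> \<omega>" "cmod \<omega> = 1"
    and f: "hardy_class f" "\<And>z. z \<in> unit_disc \<Longrightarrow> f (\<phi> z) = \<mu> * f z" and \<mu>: "\<mu> \<noteq> 0"
    and u: "u holomorphic_on unit_disc" "\<And>z. z \<in> unit_disc \<Longrightarrow> cmod (u z) \<le> B"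
  shows "hardy_approximable ((\<lambda>f z. composition_op \<phi> f z - \<mu> * f z) ` hardy2)
    (\<lambda>z. f z * ((z - \<omega>) * u z))"
  unfolding hardy_approximable_def
proof (intro allI impI)
  fix e :: real assume e: "e > 0"
  let ?p = "\<lambda>n. \<phi> ^^ n"
  define h where "h z = (z - \<omega>) * u z" for z
  have p: "?p n holomorphic_on unit_disc" "z \<in> unit_disc \<Longrightarrow> ?p n z \<in> unit_disc" for n z
    using analytic_selfmap_funpow[OF \<phi>, of n] by (auto simp: analytic_selfmap_def image_subset_iff)
  have B: "B \<ge> 0" using u(2)[of 0] norm_ge_zero order_trans by (metis centre_in_ball zero_less_one)
  have up: "(\<lambda>z. u (?p n z)) holomorphic_on unit_disc" for n
    using holomorphic_on_compose_gen[OF p(1) u(1), of n] p(2)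
    by (simp add: o_def image_subset_iff)
  have hp: "(\<lambda>z. h (?p n z)) holomorphic_on unit_disc" for n
    unfolding h_def using up p(1) by (intro holomorphic_intros)
  have hb: "cmod (h z) \<le> 2 * B" if "z \<in> unit_disc" for z
    using that norm_triangle_ineq4[of z \<omega>] \<omega>(2) u(2)[OF that] B
    unfolding h_def norm_mult by (intro mult_mono) auto
  \<comment> \<open>The iterates are bounded by 1 and their values at 0 tend to the unimodular
    \<omega>, so as multipliers they converge strongly to \<omega>.\<close>
  have "(\<lambda>n. hardy_sq (\<lambda>z. f z * (?p n z - \<omega>))) \<longlonglongrightarrow> 0"
    using p(2) by (intro hardy_contractive_multipliers_tendsto f(1) p(1) \<omega>) (auto simp: less_imp_le)
  then have "(\<lambda>n. B\<^sup>2 * hardy_sq (\<lambda>z. f z * (?p n z - \<omega>))) \<longlonglongrightarrow> B\<^sup>2 * 0"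
    by (intro tendsto_intros)
  then have "\<forall>\<^sub>F n in sequentially. B\<^sup>2 * hardy_sq (\<lambda>z. f z * (?p n z - \<omega>)) < e"
    by (rule order_tendstoD) (use e in auto)
  then obtain n where n: "B\<^sup>2 * hardy_sq (\<lambda>z. f z * (?p n z - \<omega>)) < e"
    by (auto simp: eventually_sequentially)
  \<comment> \<open>By the eigenvector equation, \<open>f * q\<close> is mapped to \<mu> f (q
    \<circ> \<phi> - q). The factor -1/\<mu> makes this f times a telescoping sum, leaving
    \<open>f * (h - h \<circ> \<phi> ^^ n)\<close>.\<close>
  define q where "q z = - (1 / \<mu>) * (\<Sum>k<n. h (?p k z))" for z
  define G where "G z = (if z \<in> unit_disc then f z * q z else 0)" for z
  have q: "q holomorphic_on unit_disc"
    unfolding q_def using hp by (intro holomorphic_intros)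
  have "cmod (q z) \<le> (1 / cmod \<mu>) * (\<Sum>k<n. 2 * B)" if "z \<in> unit_disc" for z
    unfolding q_def norm_mult norm_minus_cancel norm_divide norm_one
    using p(2)[OF that] hb by (intro mult_left_mono order_trans[OF norm_sum] sum_mono) auto
  from hardy_mult(1)[OF f(1) q this] have G: "G \<in> hardy2"
    unfolding hardy2_iff using hardy_class_cong[of G "\<lambda>z. f z * q z"] by (auto simp: G_def)
  define H where "H = (\<lambda>z. composition_op \<phi> G z - \<mu> * G z)"
  have H: "H z = f z * (h z - h (?p n z))" if z: "z \<in> unit_disc" for z
  proof -
    have \<phi>z: "\<phi> z \<in> unit_disc"
      using \<phi> z by (auto simp: analytic_selfmap_def image_subset_iff)
    have "H z = f z * ((\<Sum>k<n. h (?p k z)) - (\<Sum>k<n. h (?p k (\<phi> z))))"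
      using z \<phi>z \<mu> f(2)[OF z]
      by (simp add: H_def composition_op_def G_def q_def field_simps)
    also have "(\<Sum>k<n. h (?p k z)) - (\<Sum>k<n. h (?p k (\<phi> z))) = (\<Sum>k<n. h (?p k z) - h (?p (Suc k) z))"
      by (simp add: sum_subtractf funpow_swap1)
    also have "\<dots> = h (?p 0 z) - h (?p n z)"
      by (rule sum_lessThan_telescope')
    finally show ?thesis by simp
  qed
  have hn: "(\<lambda>z. h z - h (?p n z)) holomorphic_on unit_disc"
    using hp[of 0] hp[of n] by (intro holomorphic_intros) auto
  have "cmod (h z - h (?p n z)) \<le> 4 * B" if "z \<in> unit_disc" for z
    using norm_triangle_ineq4[of "h z" "h (?p n z)"] hb[OF that] hb[OF p(2)[OF that], of n] by simp
  from hardy_mult(1)[OF f(1) hn this] have H2: "H \<in> hardy2"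
    unfolding hardy2_iff
    using hardy_class_cong[of H "\<lambda>z. f z * (h z - h (?p n z))"] H
    by (auto simp: H_def composition_op_def G_def)
  have pw: "(\<lambda>z. ?p n z - \<omega>) holomorphic_on unit_disc"
    using p(1) by (intro holomorphic_intros)
  have pw2: "cmod (?p n z - \<omega>) \<le> 2" if "z \<in> unit_disc" for z
    using p(2)[OF that, of n] norm_triangle_ineq4[of "?p n z" \<omega>] \<omega>(2) by simp
  have uneg: "(\<lambda>z. - u (?p n z)) holomorphic_on unit_disc"
    using up by (intro holomorphic_intros)
  \<comment> \<open>The error is -f (h \<circ> \<phi>^n). By the form of \<open>h\<close> it splits
    into the small factor from above and the multiplier \<open>- u (?p n z)\<close>, bounded by
    B.\<close>
  have "hardy_sq (\<lambda>z. H z - f z * ((z - \<omega>) * u z)) =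
      hardy_sq (\<lambda>z. (f z * (?p n z - \<omega>)) * (- u (?p n z)))"
    by (rule hardy_sq_cong) (simp add: H h_def algebra_simps)
  also have "\<dots> \<le> B\<^sup>2 * hardy_sq (\<lambda>z. f z * (?p n z - \<omega>))"
    using u(2) p(2) by (intro hardy_mult(2)[OF hardy_mult(1)[OF f(1) pw pw2] uneg]) auto
  also note n
  finally show "\<exists>h \<in> (\<lambda>f z. composition_op \<phi> f z - \<mu> * f z) ` hardy2 \<inter> hardy2.
      hardy_sq (\<lambda>z. h z - f z * ((z - \<omega>) * u z)) < e"
    using H2 G by (intro bexI[of _ H]) (auto simp: H_def)
qed

section \<open>Cancelling the linear factor and the outer function\<close>

lemma norm_diff_le_norm_diff_scaled:
  fixes z \<omega> :: complex
  assumes "cmod z \<le> 1" "cmod \<omega> = 1" "1 \<le> s"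
  shows "cmod (z - \<omega>) \<le> cmod (z - of_real s * \<omega>)"
proof (rule power2_le_imp_le)
  have "z \<bullet> \<omega> \<le> 1"
    using norm_cauchy_schwarz[of z \<omega>] assms by simp
  \<comment> \<open>This product is the difference of the two squared distances; the second factor
    is nonnegative because the inner product is at most 1 and s is at least 1.\<close>
  then have "0 \<le> (s - 1) * (s + 1 - 2 * (z \<bullet> \<omega>))"
    using assms(3) by (intro mult_nonneg_nonneg) auto
  moreover have "(cmod (z - r *\<^sub>R \<omega>))\<^sup>2 = (cmod z)\<^sup>2 - 2 * r * (z \<bullet> \<omega>) + r\<^sup>2" for r
  proof -
    have "\<omega> \<bullet> \<omega> = 1" using assms(2) by (simp add: dot_square_norm)
    then show ?thesis
      unfolding power2_norm_eq_inner
      by (simp add: inner_diff_left inner_diff_right inner_commute[of \<omega> z] power2_eq_square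
          right_diff_distrib)
  qed
  from this[of 1] this[of s]
  have "(cmod (z - \<omega>))\<^sup>2 = (cmod z)\<^sup>2 - 2 * (z \<bullet> \<omega>) + 1"
    "(cmod (z - of_real s * \<omega>))\<^sup>2 = (cmod z)\<^sup>2 - 2 * s * (z \<bullet> \<omega>) + s\<^sup>2"
    by (simp_all add: scaleR_conv_of_real)
  ultimately show "(cmod (z - \<omega>))\<^sup>2 \<le> (cmod (z - of_real s * \<omega>))\<^sup>2"
    by (simp add: algebra_simps power2_eq_square)
qed auto

text \<open>The factor vanishing at \<open>\<omega>\<close> is itself cyclic: it is divided out by moving its zero
  slightly outside the closed disc.\<close>

lemma hardy_approximable_cancel_linear_factor:
  assumes f: "hardy_class f" and \<omega>: "cmod \<omega> = 1"
    and approx: "\<And>u B. u holomorphic_on unit_disc \<Longrightarrow> (\<And>z. z \<in> unit_disc \<Longrightarrow> cmod (u z) \<le> B) \<Longrightarrow>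
      hardy_approximable S (\<lambda>z. f z * ((z - \<omega>) * u z))"
    and u: "u holomorphic_on unit_disc" "\<And>z. z \<in> unit_disc \<Longrightarrow> cmod (u z) \<le> B"
  shows "hardy_approximable S (\<lambda>z. f z * u z)"
proof (rule hardy_approximable_closed)
  define s where "s m = 1 + 1 / real (Suc m)" for m
  \<comment> \<open>The pole \<open>s m * \<omega>\<close> lies outside the closed disc and moves to
    \<omega>. The quotient is bounded by 1 and equals 1/s_m at the origin, so it converges strongly
    to 1.\<close>
  define v where "v m z = (z - \<omega>) / (z - of_real (s m) * \<omega>)" for m z
  show fu: "hardy_class (\<lambda>z. f z * u z)" by (rule hardy_mult(1)[OF f u])
  have s: "s m > 1" for m by (simp add: s_def)
  have away: "s m - 1 \<le> cmod (z - of_real (s m) * \<omega>)" if "z \<in> unit_disc" for m z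
    using that \<omega> s[of m] norm_triangle_ineq2[of "of_real (s m) * \<omega>" z]
    by (simp add: norm_mult norm_minus_commute)
  then have nz: "z - of_real (s m) * \<omega> \<noteq> 0" if "z \<in> unit_disc" for m z
    using that s[of m] by (metis diff_gt_0_iff_gt norm_zero not_less)
  have v: "v m holomorphic_on unit_disc" for m
    unfolding v_def using nz by (intro holomorphic_intros) auto
  have v1: "cmod (v m z) \<le> 1" if "z \<in> unit_disc" for m z
    using norm_diff_le_norm_diff_scaled[of z \<omega> "s m"] that \<omega> s[of m] nz[OF that, of m]
    by (simp add: v_def norm_divide divide_le_eq_1)
  have "(\<lambda>m. 1 / s m) \<longlonglongrightarrow> 1 / (1 + 0)"
    unfolding s_def using LIMSEQ_inverse_real_of_nat
    by (intro tendsto_intros) (auto simp: inverse_eq_divide)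
  then have "(\<lambda>m. complex_of_real (1 / s m)) \<longlonglongrightarrow> of_real 1"
    by (intro tendsto_of_real) simp
  moreover have "v m 0 = of_real (1 / s m)" for m
    using \<omega> by (auto simp: v_def)
  ultimately have "(\<lambda>m. v m 0) \<longlonglongrightarrow> 1" by simp
  from hardy_contractive_multipliers_tendsto[OF fu v v1 this]
  have lim: "(\<lambda>m. hardy_sq (\<lambda>z. f z * u z * (v m z - 1))) \<longlonglongrightarrow> 0" by simp
  fix e :: real assume "e > 0"
  then have "\<forall>\<^sub>F m in sequentially. hardy_sq (\<lambda>z. f z * u z * (v m z - 1)) < e"
    by (rule order_tendstoD(2)[OF lim])
  then obtain m where m: "hardy_sq (\<lambda>z. f z * u z * (v m z - 1)) < e"
    by (auto simp: eventually_sequentially)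
  \<comment> \<open>The pole has distance at least s_m - 1 from the disc, so \<open>w\<close> is an
    admissible bounded multiplier, with (z - \<omega>) w = v_m u.\<close>
  define w where "w z = u z / (z - of_real (s m) * \<omega>)" for z
  have w: "w holomorphic_on unit_disc"
    unfolding w_def using nz u(1) by (intro holomorphic_intros) auto
  have wb: "cmod (w z) \<le> B / (s m - 1)" if "z \<in> unit_disc" for z
    unfolding w_def norm_divide using away[OF that, of m] u(2)[OF that] s[of m]
    by (intro frac_le) (auto intro: order_trans[OF norm_ge_zero])
  have vw: "(z - \<omega>) * w z = v m z * u z" for z by (simp add: v_def w_def)
  show "\<exists>g'. hardy_class g' \<and> hardy_approximable S g' \<and> hardy_sq (\<lambda>z. g' z - f z * u z) < e"
  proof (intro exI conjI)
    show "hardy_approximable S (\<lambda>z. f z * ((z - \<omega>) * w z))"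
      by (rule approx[OF w wb])
    have "(\<lambda>z. f z * ((z - \<omega>) * w z)) = (\<lambda>z. (f z * u z) * v m z)"
      by (simp only: vw) (simp add: mult_ac)
    then show "hardy_class (\<lambda>z. f z * ((z - \<omega>) * w z))"
      using hardy_mult(1)[OF fu v v1] by simp
    have "(\<lambda>z. f z * ((z - \<omega>) * w z) - f z * u z) = (\<lambda>z. f z * u z * (v m z - 1))"
      by (simp only: vw) (simp add: algebra_simps)
    then show "hardy_sq (\<lambda>z. f z * ((z - \<omega>) * w z) - f z * u z) < e"
      using m by simp
  qed
qed

text \<open>Polynomials are dense, and a polynomial \<open>p\<close> is approximated by
  \<open>p * (f * u n * cnj c)\<close>, where the \<open>u n\<close> are the bounded approximate
  inverses of \<open>f\<close>. Boundedness of \<open>p\<close> is what makes the cofactor of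
  \<open>f\<close> a bounded function.\<close>

lemma outer_function_cyclic:
  assumes outer: "outer_function f" and f: "hardy_class f"
    and approx: "\<And>u B. u holomorphic_on unit_disc \<Longrightarrow> (\<And>z. z \<in> unit_disc \<Longrightarrow> cmod (u z) \<le> B) \<Longrightarrow>
      hardy_approximable S (\<lambda>z. f z * u z)"
    and g: "hardy_class g"
  shows "hardy_approximable S g"
proof (rule hardy_approximable_closed[OF g])
  fix e :: real assume e: "e > 0"
  obtain a K where "hardy_sq (\<lambda>z. g z - (\<Sum>k<K. a k * z ^ k)) < e"
    using hardy_polynomial_approx[OF g e] .
  moreover define p where "p z = (\<Sum>k<K. a k * z ^ k)" for z
  ultimately have gp: "hardy_sq (\<lambda>z. g z - p z) < e" by simp
  define A where "A = (\<Sum>k<K. cmod (a k))"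
  have p: "p holomorphic_on unit_disc" "\<And>z. z \<in> unit_disc \<Longrightarrow> cmod (p z) \<le> A"
    unfolding p_def A_def by (auto intro!: holomorphic_intros polynomial_bounded_on_disc)
  note ph = hardy_bounded(1)[OF p]
  have "hardy_approximable S p"
  proof (rule hardy_approximable_closed[OF ph])
    fix d :: real assume d: "d > 0"
    obtain c u B where c: "cmod c = 1" and u: "\<And>n::nat. u n holomorphic_on unit_disc"
      "\<And>n z. z \<in> unit_disc \<Longrightarrow> cmod (u n z) \<le> B n"
      and fu: "\<And>n z. z \<in> unit_disc \<Longrightarrow> cmod (f z * u n z) \<le> 1"
      and lim: "(\<lambda>n. f 0 * u n 0) \<longlonglongrightarrow> c"
      using outer_function_bounded_inverse_approx[OF outer] by blast
    \<comment> \<open>The factor \<open>cnj c\<close> rotates the limit of the values at the origin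
      from c to 1.\<close>
    define v where "v n z = f z * (u n z * cnj c)" for n z
    have v: "v n holomorphic_on unit_disc" for n
      unfolding v_def using u(1) f by (intro holomorphic_intros) (auto simp: hardy_class_def)
    have v1: "cmod (v n z) \<le> 1" if "z \<in> unit_disc" for n z
      using fu[OF that, of n] c by (simp add: v_def norm_mult)
    have "(\<lambda>n. (f 0 * u n 0) * cnj c) \<longlonglongrightarrow> c * cnj c"
      by (intro tendsto_intros lim)
    then have "(\<lambda>n. v n 0) \<longlonglongrightarrow> 1"
      using c by (simp add: v_def mult.assoc complex_norm_square[symmetric])
    from hardy_contractive_multipliers_tendsto[OF ph v v1 this]
    have "(\<lambda>n. hardy_sq (\<lambda>z. p z * (v n z - 1))) \<longlonglongrightarrow> 0" by simp
    then have "\<forall>\<^sub>F n in sequentially. hardy_sq (\<lambda>z. p z * (v n z - 1)) < d"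
      using d by (rule order_tendstoD(2))
    then obtain n where n: "hardy_sq (\<lambda>z. p z * (v n z - 1)) < d"
      by (auto simp: eventually_sequentially)
    define w where "w z = u n z * cnj c * p z" for z
    have w: "w holomorphic_on unit_disc"
      unfolding w_def using u(1) p(1) by (intro holomorphic_intros)
    have wb: "cmod (w z) \<le> B n * A" if "z \<in> unit_disc" for z
      using u(2)[OF that, of n] p(2)[OF that] c
      by (auto simp: w_def norm_mult intro!: mult_mono intro: order_trans[OF norm_ge_zero])
    have vw: "p z * v n z = f z * w z" for z by (simp add: v_def w_def mult_ac)
    have diff: "(\<lambda>z. p z * (v n z - 1)) = (\<lambda>z. f z * w z - p z)"
      by (simp add: right_diff_distrib vw)
    show "\<exists>g'. hardy_class g' \<and> hardy_approximable S g' \<and> hardy_sq (\<lambda>z. g' z - p z) < d"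
      using hardy_mult(1)[OF f w wb] approx[OF w wb] n unfolding diff by blast
  qed
  moreover have "hardy_sq (\<lambda>z. p z - g z) = hardy_sq (\<lambda>z. g z - p z)"
    using g p(1) unfolding hardy_sq_def
    by (simp add: maclaurin_coeff_diff hardy_class_def norm_minus_commute)
  ultimately show "\<exists>g'. hardy_class g' \<and> hardy_approximable S g' \<and> hardy_sq (\<lambda>z. g' z - g z) < e"
    using gp ph by auto
qed

theorem proposition3p1:
  fixes \<phi> :: "complex \<Rightarrow> complex" and \<omega> \<mu> :: complex
  assumes "analytic_selfmap \<phi>"
    and "denjoy_wolff_point \<phi> \<omega>"
    and "\<omega> \<in> frontier unit_disc"
    and "\<exists>f. hardy2_eigenvector (composition_op \<phi>) \<mu> f \<and> outer_function f"
  shows "dense_in_hardy2 ((\<lambda>f z. composition_op \<phi> f z - \<mu> * f z) ` hardy2)"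
proof -
  obtain f where eig: "hardy2_eigenvector (composition_op \<phi>) \<mu> f" and outer: "outer_function f"
    using assms(4) by blast
  have f: "hardy_class f" using eig by (simp add: hardy2_eigenvector_def hardy2_iff)
  have f\<phi>: "f (\<phi> z) = \<mu> * f z" if "z \<in> unit_disc" for z
    using eig that unfolding hardy2_eigenvector_def composition_op_def by metis
  \<comment> \<open>An outer function is a unimodular constant times an exponential, so it has no
    zeros; evaluating the eigenvector equation at 0 then excludes \<mu> = 0.\<close>
  have fnz: "f z \<noteq> 0" if "z \<in> unit_disc" for z
    using outer that unfolding outer_function_def by fastforce
  have "f (\<phi> 0) \<noteq> 0" using assms(1) by (intro fnz) (auto simp: analytic_selfmap_def image_subset_iff)
  then have \<mu>: "\<mu> \<noteq> 0" using f\<phi>[of 0] by auto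
  have \<omega>: "(\<lambda>n. (\<phi> ^^ n) 0) \<longlonglongrightarrow> \<omega>" "cmod \<omega> = 1"
    using assms(2,3) by (auto simp: denjoy_wolff_point_def)
  show ?thesis
    unfolding dense_in_hardy2_iff
  proof
    fix g assume "g \<in> hardy2"
    then have g: "hardy_class g" by (simp add: hardy2_iff)
    show "hardy_approximable ((\<lambda>f z. composition_op \<phi> f z - \<mu> * f z) ` hardy2) g"
      using outer f _ g
    proof (rule outer_function_cyclic)
      fix u B assume "u holomorphic_on unit_disc" "\<And>z. z \<in> unit_disc \<Longrightarrow> cmod (u z) \<le> B"
      with f \<omega>(2) composition_op_range_approximates[OF assms(1) \<omega> f f\<phi> \<mu>]
      show "hardy_approximable ((\<lambda>f z. composition_op \<phi> f z - \<mu> * f z) ` hardy2) (\<lambda>z. f z * u z)"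
        by (rule hardy_approximable_cancel_linear_factor)
    qed
  qed
qed

end
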